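(* Let $\mathbb A$ be a relational structure. The following are equivalent: 1. $\mathbb A$ has a commutativity gadget. 2. $\mathbb A^n$ is a commutativity gadget for $\mathbb A$ (for a suitable choice of the two distinguished elements) for all large enough $n\in\mathbb N$. 3. All quantum polymorphisms of $\mathbb A$ are non-contextual.
   Context: Structures: a signature $\sigma$ is a finite set of relation symbols $R$ with arities $\mathrm{ar}(R)\ge 1$; a $\sigma$-structure $\mathbb A$ consists of a finite domain $A$ and relations $R^{\mathbb A}\subseteq A^{\mathrm{ar}(R)}$ for $R\in\sigma$. All structures are finite. $\mathrm{Gaif}(\mathbb A)$ is the loopless undirected graph on $A$ in which distinct $x,y$ are adjacent iff they occur together in some tuple of some relation of $\mathbb A$. For $n\ge 1$, the power $\mathbb A^n$ has domain $A^n$, and $(\mathbf b_1,\dots,\mathbf b_r)\in R^{\mathbb A^n}$ iff for every $i\in[n]$ the tuple of $i$-th coordinates lies in $R^{\mathbb A}$. Quantum homomorphisms: a projector on a finite-dimensional Hilbert space $H$ is an operator $p$ with $p=p^*=p^2$. A PVM on $H$ with outcome set $B$ is a family $(Q_b)_{b\in B}$ of projectors with $\sum_b Q_b=\mathrm{id}$. A quantum function $Q$ from $A$ to $B$ is a family of PVMs $(Q_{a,b})_{b\in B}$, one for each $a\in A$, all over the same non-trivial finite-dimensional Hilbert space. It is non-contextual if $Q_{a,b}Q_{a',b'}=Q_{a',b'}Q_{a,b}$ for all $a,a'\in A$, $b,b'\in B$. A quantum homomorphism $Q:\mathbb A\to_q\mathbb B$ between $\sigma$-structures is a quantum function from $A$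 to $B$ such that (QH1) $\prod_{i=1}^{\mathrm{ar}(R)}Q_{a_i,b_i}=0$ for all $R\in\sigma$, $\mathbf a\in R^{\mathbb A}$, $\mathbf b\in B^{\mathrm{ar}(R)}\setminus R^{\mathbb B}$; (QH2) $Q_{a,b}Q_{a',b'}=Q_{a',b'}Q_{a,b}$ for all $\{a,a'\}\in E(\mathrm{Gaif}(\mathbb A))$ and $b,b'\in B$. A quantum polymorphism of $\mathbb A$ is a quantum homomorphism $\mathbb A^n\to_q\mathbb A$ for some $n\ge1$. A commutativity gadget for a $\sigma$-structure $\mathbb A$ is a $\sigma$-structure $\mathbb G$ with two distinguished elements $u,v\in G$ such that (c1) for any two PVMs $(P_a)_{a\in A}$ and $(P'_a)_{a\in A}$ over the same non-trivial finite-dimensional Hilbert space with $P_aP'_b=P'_bP_a$ for all $a,b\in A$, there is a quantum homomorphism $Q:\mathbb G\to_q\mathbb A$ with $Q_{u,a}=P_a$ and $Q_{v,a}=P'_a$ for all $a\in A$; (c2) for every quantum homomorphism $Q:\mathbb G\to_q\mathbb A$ and all $a,b\in A$, $Q_{u,a}Q_{v,b}=Q_{v,b}Q_{u,a}$. *)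

theory Defs
  imports "Jordan_Normal_Form.Schur_Decomposition"
begin

section \<open>Relational structures\<close>

record 'r signature =
  symbols :: "'r set"
  arity :: "'r \<Rightarrow> nat"

definition is_signature :: "'r signature \<Rightarrow> bool" where
  "is_signature \<sigma> \<longleftrightarrow> finite (symbols \<sigma>) \<and> (\<forall>R\<in>symbols \<sigma>. arity \<sigma> R \<ge> 1)"

record ('a, 'r) rel_struct =
  universe :: "'a set"
  interp :: "'r \<Rightarrow> 'a list set"

definition tuples :: "'a set \<Rightarrow> nat \<Rightarrow> 'a list set" where
  "tuples A n = {xs. set xs \<subseteq> A \<and> length xs = n}"

definition is_structure :: "'r signature \<Rightarrow> ('a, 'r) rel_struct \<Rightarrow> bool" where
  "is_structure \<sigma> A \<longleftrightarrow>
     finite (universe A) \<and>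
     (\<forall>R\<in>symbols \<sigma>. interp A R \<subseteq> tuples (universe A) (arity \<sigma> R))"

definition gaifman_edges :: "'r signature \<Rightarrow> ('a, 'r) rel_struct \<Rightarrow> 'a set set" where
  "gaifman_edges \<sigma> A =
     {{x, y} | x y. x \<noteq> y \<and> (\<exists>R\<in>symbols \<sigma>. \<exists>t\<in>interp A R. x \<in> set t \<and> y \<in> set t)}"

definition struct_power ::
    "'r signature \<Rightarrow> ('a, 'r) rel_struct \<Rightarrow> nat \<Rightarrow> ('a list, 'r) rel_struct" where
  "struct_power \<sigma> A n =
     \<lparr>universe = tuples (universe A) n,
      interp = (\<lambda>R. {bs \<in> tuples (tuples (universe A) n) (arity \<sigma> R).
                       \<forall>i<n. map (\<lambda>b. b ! i) bs \<in> interp A R})\<rparr>"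


section \<open>Quantum homomorphisms\<close>

text \<open>The Hilbert space of dimension \<open>d\<close> is taken to be \<open>\<complex>\<^sup>d\<close> with its standard inner product, and
  operators on it are complex \<open>d \<times> d\<close> matrices. Every finite-dimensional Hilbert space is unitarily
  isomorphic to one of these, and the space is non-trivial iff \<open>d > 0\<close>.\<close>

definition projector :: "nat \<Rightarrow> complex mat \<Rightarrow> bool" where
  "projector d p \<longleftrightarrow> p \<in> carrier_mat d d \<and> mat_adjoint p = p \<and> p * p = p"

definition pvm :: "nat \<Rightarrow> 'b set \<Rightarrow> ('b \<Rightarrow> complex mat) \<Rightarrow> bool" where
  "pvm d B P \<longleftrightarrow>
     (\<forall>b\<in>B. projector d (P b)) \<and>
     finsum (module_mat TYPE(complex) d d) P B = 1\<^sub>m d"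

definition quantum_function ::
    "nat \<Rightarrow> 'a set \<Rightarrow> 'b set \<Rightarrow> ('a \<Rightarrow> 'b \<Rightarrow> complex mat) \<Rightarrow> bool" where
  "quantum_function d A B Q \<longleftrightarrow> d > 0 \<and> (\<forall>a\<in>A. pvm d B (Q a))"

definition non_contextual :: "'a set \<Rightarrow> 'b set \<Rightarrow> ('a \<Rightarrow> 'b \<Rightarrow> complex mat) \<Rightarrow> bool" where
  "non_contextual A B Q \<longleftrightarrow>
     (\<forall>a\<in>A. \<forall>a'\<in>A. \<forall>b\<in>B. \<forall>b'\<in>B. Q a b * Q a' b' = Q a' b' * Q a b)"

text \<open>The matrix type is not a monoid (the unit depends on the dimension), so ordered products are
  written as folds.\<close>

definition mat_prod_list :: "nat \<Rightarrow> complex mat list \<Rightarrow> complex mat" where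
  "mat_prod_list d Ms = foldr (*) Ms (1\<^sub>m d)"

definition quantum_hom ::
    "'r signature \<Rightarrow> ('a, 'r) rel_struct \<Rightarrow> ('b, 'r) rel_struct \<Rightarrow> nat
      \<Rightarrow> ('a \<Rightarrow> 'b \<Rightarrow> complex mat) \<Rightarrow> bool" where
  "quantum_hom \<sigma> A B d Q \<longleftrightarrow>
     quantum_function d (universe A) (universe B) Q \<and>
     (\<forall>R\<in>symbols \<sigma>. \<forall>as\<in>interp A R. \<forall>bs\<in>tuples (universe B) (arity \<sigma> R) - interp B R.
        mat_prod_list d (map2 Q as bs) = 0\<^sub>m d d) \<and>
     (\<forall>a a'. {a, a'} \<in> gaifman_edges \<sigma> A \<longrightarrow>
        (\<forall>b\<in>universe B. \<forall>b'\<in>universe B. Q a b * Q a' b' = Q a' b' * Q a b))"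

definition quantum_polymorphism ::
    "'r signature \<Rightarrow> ('a, 'r) rel_struct \<Rightarrow> nat \<Rightarrow> nat \<Rightarrow> ('a list \<Rightarrow> 'a \<Rightarrow> complex mat) \<Rightarrow> bool" where
  "quantum_polymorphism \<sigma> A n d Q \<longleftrightarrow> n \<ge> 1 \<and> quantum_hom \<sigma> (struct_power \<sigma> A n) A d Q"


section \<open>Commutativity gadgets\<close>

text \<open>The distinguished elements \<open>u\<close> and \<open>v\<close> are not required to be different.\<close>

definition commutativity_gadget ::
    "'r signature \<Rightarrow> ('a, 'r) rel_struct \<Rightarrow> ('g, 'r) rel_struct \<Rightarrow> 'g \<Rightarrow> 'g \<Rightarrow> bool" where
  "commutativity_gadget \<sigma> A G u v \<longleftrightarrow>
     is_structure \<sigma> G \<and> u \<in> universe G \<and> v \<in> universe G \<and>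
     (\<forall>d>0. \<forall>P P'. pvm d (universe A) P \<and> pvm d (universe A) P' \<and>
        (\<forall>a\<in>universe A. \<forall>b\<in>universe A. P a * P' b = P' b * P a) \<longrightarrow>
        (\<exists>Q. quantum_hom \<sigma> G A d Q \<and>
             (\<forall>a\<in>universe A. Q u a = P a \<and> Q v a = P' a))) \<and>
     (\<forall>d Q. quantum_hom \<sigma> G A d Q \<longrightarrow>
        (\<forall>a\<in>universe A. \<forall>b\<in>universe A. Q u a * Q v b = Q v b * Q u a))"

text \<open>A structure of an arbitrary type is finite, hence isomorphic to one whose domain consists of
  natural numbers, so existence is expressed over that type. Lemma \<open>has_commutativity_gadgetI\<close>
  confirms that a gadget of any type suffices.\<close>

definition has_commutativity_gadget :: "'r signature \<Rightarrow> ('a, 'r) rel_struct \<Rightarrow> bool" where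
  "has_commutativity_gadget \<sigma> A \<longleftrightarrow>
     (\<exists>(G :: (nat, 'r) rel_struct) u v. commutativity_gadget \<sigma> A G u v)"

definition struct_image :: "('a \<Rightarrow> 'b) \<Rightarrow> ('a, 'r) rel_struct \<Rightarrow> ('b, 'r) rel_struct" where
  "struct_image f A = \<lparr>universe = f ` universe A, interp = (\<lambda>R. map f ` interp A R)\<rparr>"

lemma gaifman_edges_iff:
  "{x, y} \<in> gaifman_edges \<sigma> A \<longleftrightarrow>
     x \<noteq> y \<and> (\<exists>R\<in>symbols \<sigma>. \<exists>t\<in>interp A R. x \<in> set t \<and> y \<in> set t)"
  unfolding gaifman_edges_def by (auto simp: doubleton_eq_iff)

lemma gaifman_edges_subset:
  assumes "is_structure \<sigma> A" and "{x, y} \<in> gaifman_edges \<sigma> A"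
  shows "x \<in> universe A" "y \<in> universe A"
  using assms unfolding gaifman_edges_def is_structure_def tuples_def
  by (fastforce simp: doubleton_eq_iff)+

lemma gaifman_edges_image:
  assumes inj: "inj_on f (universe G)" and G: "is_structure \<sigma> G"
    and x: "x \<in> universe G" and y: "y \<in> universe G"
  shows "{f x, f y} \<in> gaifman_edges \<sigma> (struct_image f G) \<longleftrightarrow> {x, y} \<in> gaifman_edges \<sigma> G"
proof -
  have *: "f z \<in> f ` set t \<longleftrightarrow> z \<in> set t"
    if "R \<in> symbols \<sigma>" "t \<in> interp G R" "z \<in> universe G" for z t R
    using that inj G unfolding is_structure_def tuples_def
    by (intro inj_on_image_mem_iff[of f "universe G"]) auto
  show ?thesis unfolding gaifman_edges_iff struct_image_def
    using * x y inj by (auto simp: inj_on_eq_iff)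
qed

lemma quantum_hom_image:
  assumes inj: "inj_on f (universe G)" and G: "is_structure \<sigma> G"
  shows "quantum_hom \<sigma> (struct_image f G) A d Q \<longleftrightarrow> quantum_hom \<sigma> G A d (\<lambda>x. Q (f x))"
proof -
  have G': "is_structure \<sigma> (struct_image f G)"
    using G unfolding is_structure_def tuples_def struct_image_def by fastforce
  have map: "map2 Q (map f as) bs = map2 (\<lambda>x. Q (f x)) as bs" for as bs
    by (induction as bs rule: list_induct2') auto
  have "(\<forall>a a'. {a, a'} \<in> gaifman_edges \<sigma> (struct_image f G) \<longrightarrow> C a a') \<longleftrightarrow>
        (\<forall>a a'. {a, a'} \<in> gaifman_edges \<sigma> G \<longrightarrow> C (f a) (f a'))" (is "?L \<longleftrightarrow> ?R") for C
  proof
    assume ?L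
    then show ?R using gaifman_edges_image[OF inj G] gaifman_edges_subset[OF G] by blast
  next
    assume R: ?R
    show ?L
    proof (intro allI impI)
      fix a a' assume e: "{a, a'} \<in> gaifman_edges \<sigma> (struct_image f G)"
      then have "a \<in> f ` universe G" "a' \<in> f ` universe G"
        using gaifman_edges_subset[OF G' e] by (auto simp: struct_image_def)
      then show "C a a'" using R e gaifman_edges_image[OF inj G] by blast
    qed
  qed
  from this[of "\<lambda>a a'. \<forall>b\<in>universe A. \<forall>b'\<in>universe A. Q a b * Q a' b' = Q a' b' * Q a b"]
  show ?thesis
    unfolding quantum_hom_def quantum_function_def by (simp add: struct_image_def map)
qed

lemma has_commutativity_gadgetI:
  fixes A :: "('a, 'r) rel_struct" and G :: "('g, 'r) rel_struct"
  assumes g: "commutativity_gadget \<sigma> A G u v"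
  shows "has_commutativity_gadget \<sigma> A"
proof -
  have G: "is_structure \<sigma> G" and u: "u \<in> universe G" and v: "v \<in> universe G"
    using g unfolding commutativity_gadget_def by auto
  then have "finite (universe G)" unfolding is_structure_def by auto
  then obtain f :: "'g \<Rightarrow> nat" where inj: "inj_on f (universe G)"
    using finite_imp_inj_to_nat_seg by metis
  let ?H = "struct_image f G" and ?g = "inv_into (universe G) f"
  have H: "is_structure \<sigma> ?H"
    using G unfolding is_structure_def tuples_def struct_image_def by fastforce
  have mem: "f u \<in> universe ?H" "f v \<in> universe ?H"
    using u v by (auto simp: struct_image_def)
  have pull: "quantum_hom \<sigma> ?H A d (\<lambda>x. Q (?g x))" if Q: "quantum_hom \<sigma> G A d Q" for d Q
  proof -
    have 1: "as \<in> interp G R \<Longrightarrow> R \<in> symbols \<sigma> \<Longrightarrow> map2 (\<lambda>x. Q (?g (f x))) as bs = map2 Q as bs"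
      for as bs R
    proof -
      assume "as \<in> interp G R" "R \<in> symbols \<sigma>"
      then have "set as \<subseteq> universe G"
        using G unfolding is_structure_def tuples_def by auto
      then show ?thesis
        using inv_into_f_f[OF inj] by (intro map_cong) (auto dest!: set_zip_leftD)
    qed
    have 2: "{a, a'} \<in> gaifman_edges \<sigma> G \<Longrightarrow> ?g (f a) = a \<and> ?g (f a') = a'" for a a'
      using gaifman_edges_subset[OF G] inj by auto
    show ?thesis unfolding quantum_hom_image[OF inj G]
      using Q inj unfolding quantum_hom_def quantum_function_def
      by (simp add: 1 2 del: map_eq_conv cong: ball_cong) blast
  qed
  have "commutativity_gadget \<sigma> A ?H (f u) (f v)"
    unfolding commutativity_gadget_def
  proof (intro conjI H mem allI impI)
    fix d :: nat and P P' :: "'a \<Rightarrow> complex mat"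
    assume d: "d > 0" and PP: "pvm d (universe A) P \<and> pvm d (universe A) P' \<and>
      (\<forall>a\<in>universe A. \<forall>b\<in>universe A. P a * P' b = P' b * P a)"
    have "\<forall>d>0. \<forall>P P'. pvm d (universe A) P \<and> pvm d (universe A) P' \<and>
        (\<forall>a\<in>universe A. \<forall>b\<in>universe A. P a * P' b = P' b * P a) \<longrightarrow>
        (\<exists>Q. quantum_hom \<sigma> G A d Q \<and>
             (\<forall>a\<in>universe A. Q u a = P a \<and> Q v a = P' a))"
      using g unfolding commutativity_gadget_def by (elim conjE)
    from this[rule_format, OF d PP] obtain Q where Q: "quantum_hom \<sigma> G A d Q"
      and eq: "\<And>a. a \<in> universe A \<Longrightarrow> Q u a = P a \<and> Q v a = P' a"
      by blast
    have "\<forall>a\<in>universe A. Q (?g (f u)) a = P a \<and> Q (?g (f v)) a = P' a"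
      by (simp add: eq inv_into_f_f[OF inj] u v)
    with pull[OF Q] show "\<exists>Q. quantum_hom \<sigma> ?H A d Q \<and>
        (\<forall>a\<in>universe A. Q (f u) a = P a \<and> Q (f v) a = P' a)"
      by (intro exI[of _ "\<lambda>x. Q (?g x)"] conjI)
  next
    fix d :: nat and Q
    assume "quantum_hom \<sigma> ?H A d Q"
    then have "quantum_hom \<sigma> G A d (\<lambda>x. Q (f x))" unfolding quantum_hom_image[OF inj G] .
    then show "\<forall>a\<in>universe A. \<forall>b\<in>universe A. Q (f u) a * Q (f v) b = Q (f v) b * Q (f u) a"
      using g unfolding commutativity_gadget_def by blast
  qed
  then show ?thesis unfolding has_commutativity_gadget_def by blast
qed

end

theory Submission
  imports Defs
begin

text \<open>A gadget \<open>G\<close> forces non-contextuality: for \<open>x, y\<close> in the power and each coordinate \<open>i\<close>, the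
  deterministic PVMs at \<open>x ! i\<close> and \<open>y ! i\<close> over the one-dimensional space extend to a quantum
  homomorphism from \<open>G\<close>, which in dimension one is a classical homomorphism. These assemble to a
  homomorphism from \<open>G\<close> to the power sending \<open>u, v\<close> to \<open>x, y\<close>; pulling a quantum polymorphism
  back along it, the gadget makes the PVMs at \<open>x\<close> and \<open>y\<close> commute.

  Conversely, if \<open>n \<ge> |A|\<^sup>2\<close>, choose \<open>u\<close> and \<open>v\<close> such that every pair \<open>(a, b)\<close> occurs as
  \<open>(u ! k, v ! k)\<close> at some coordinate \<open>k\<close>. Commuting PVMs \<open>P, P'\<close> have the joint PVM
  \<open>P a * P' b\<close>, and mixing the coordinate projections \<open>x \<mapsto> x ! k\<close> according to it yields a quantum
  homomorphism with marginal \<open>P\<close> at \<open>u\<close> and \<open>P'\<close> at \<open>v\<close>.\<close>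

section \<open>Sums of matrices and PVMs\<close>

text \<open>Summing entry by entry keeps the dimension explicit even for an empty index set, and
  turns distributivity into an exchange of finite complex sums.\<close>

definition mat_sum :: "nat \<Rightarrow> ('i \<Rightarrow> complex mat) \<Rightarrow> 'i set \<Rightarrow> complex mat" where
  "mat_sum d E I = mat d d (\<lambda>ij. \<Sum>p\<in>I. E p $$ ij)"

lemma mat_sum_carrier [simp]: "mat_sum d E I \<in> carrier_mat d d"
  by (simp add: mat_sum_def)

lemma mat_sum_dim [simp]: "dim_row (mat_sum d E I) = d" "dim_col (mat_sum d E I) = d"
  by (simp_all add: mat_sum_def)

lemma mat_sum_index: "i < d \<Longrightarrow> j < d \<Longrightarrow> mat_sum d E I $$ (i, j) = (\<Sum>p\<in>I. E p $$ (i, j))"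
  by (simp add: mat_sum_def)

lemma mat_sum_empty: "mat_sum d E {} = 0\<^sub>m d d"
  by (rule eq_matI) (auto simp: mat_sum_index)

lemma mat_sum_cong: "(\<And>p. p \<in> I \<Longrightarrow> E p = F p) \<Longrightarrow> mat_sum d E I = mat_sum d F I"
  unfolding mat_sum_def by (intro cong_mat refl sum.cong) auto

text \<open>Bridge from the module sum in the definition of \<open>pvm\<close> to the entrywise sum
  used in all later computations.\<close>

lemma finsum_module_mat:
  assumes "finite I" and "\<And>p. p \<in> I \<Longrightarrow> E p \<in> carrier_mat d d"
  shows "finsum (module_mat TYPE(complex) d d) E I = mat_sum d E I"
proof -
  interpret abelian_group "module_mat TYPE(complex) d d" by (rule abelian_group_mat)
  show ?thesis using assms
  proof (induction I rule: finite_induct)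
    case empty
    then show ?case by (simp add: mat_sum_empty module_mat_simps)
  next
    case (insert x F)
    have "finsum (module_mat TYPE(complex) d d) E (insert x F) = E x + mat_sum d E F"
      using insert finsum_insert[of F x E] by (auto simp: module_mat_simps)
    also have "\<dots> = mat_sum d E (insert x F)"
      using insert.hyps insert.prems[of x] by (intro eq_matI) (auto simp: mat_sum_index)
    finally show ?case .
  qed
qed

lemma mat_mult_index:
  assumes "X \<in> carrier_mat d d" "Y \<in> carrier_mat d d" "i < d" "j < d"
  shows "(X * Y) $$ (i, j) = (\<Sum>k<d. X $$ (i, k) * Y $$ (k, j))"
  using assms by (simp add: scalar_prod_def atLeast0LessThan)

lemma mat_sum_mult_left:
  assumes X: "X \<in> carrier_mat d d" and E: "\<And>p. p \<in> I \<Longrightarrow> E p \<in> carrier_mat d d"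
  shows "X * mat_sum d E I = mat_sum d (\<lambda>p. X * E p) I"
proof (rule eq_matI)
  fix i j assume "i < dim_row (mat_sum d (\<lambda>p. X * E p) I)" "j < dim_col (mat_sum d (\<lambda>p. X * E p) I)"
  then have ij: "i < d" "j < d" by auto
  have "(\<Sum>k<d. X $$ (i, k) * mat_sum d E I $$ (k, j)) =
        (\<Sum>k<d. \<Sum>p\<in>I. X $$ (i, k) * E p $$ (k, j))"
    using ij by (simp add: mat_sum_index sum_distrib_left)
  also have "\<dots> = (\<Sum>p\<in>I. \<Sum>k<d. X $$ (i, k) * E p $$ (k, j))"
    by (rule sum.swap)
  finally show "(X * mat_sum d E I) $$ (i, j) = mat_sum d (\<lambda>p. X * E p) I $$ (i, j)"
    using ij X E by (simp add: mat_mult_index[of _ d] mat_sum_index del: index_mult_mat)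
qed (use X in auto)

lemma mat_sum_mult_right:
  assumes X: "X \<in> carrier_mat d d" and E: "\<And>p. p \<in> I \<Longrightarrow> E p \<in> carrier_mat d d"
  shows "mat_sum d E I * X = mat_sum d (\<lambda>p. E p * X) I"
proof (rule eq_matI)
  fix i j assume "i < dim_row (mat_sum d (\<lambda>p. E p * X) I)" "j < dim_col (mat_sum d (\<lambda>p. E p * X) I)"
  then have ij: "i < d" "j < d" by auto
  have "(\<Sum>k<d. mat_sum d E I $$ (i, k) * X $$ (k, j)) =
        (\<Sum>k<d. \<Sum>p\<in>I. E p $$ (i, k) * X $$ (k, j))"
    using ij by (simp add: mat_sum_index sum_distrib_right)
  also have "\<dots> = (\<Sum>p\<in>I. \<Sum>k<d. E p $$ (i, k) * X $$ (k, j))"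
    by (rule sum.swap)
  finally show "(mat_sum d E I * X) $$ (i, j) = mat_sum d (\<lambda>p. E p * X) I $$ (i, j)"
    using ij X E by (simp add: mat_mult_index[of _ d] mat_sum_index del: index_mult_mat)
qed (use X in auto)

section \<open>Adjoints of products and sums\<close>

lemma mat_adjoint_carrier: "X \<in> carrier_mat d e \<Longrightarrow> mat_adjoint X \<in> carrier_mat e d"
  by (auto simp: mat_adjoint_def)

lemma mat_adjoint_index:
  assumes "X \<in> carrier_mat d e" "i < e" "j < d"
  shows "mat_adjoint X $$ (i, j) = conjugate (X $$ (j, i))"
  using assms by (simp add: mat_adjoint_def mat_of_rows_index)

lemma mat_adjoint_mult:
  fixes X Y :: "complex mat"
  assumes "X \<in> carrier_mat d d" "Y \<in> carrier_mat d d"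
  shows "mat_adjoint (X * Y) = mat_adjoint Y * mat_adjoint X"
proof (rule eq_matI)
  have XY: "X * Y \<in> carrier_mat d d" using assms by auto
  note c = XY assms mat_adjoint_carrier[OF assms(1)] mat_adjoint_carrier[OF assms(2)]
    mat_adjoint_carrier[OF XY]
  fix i j assume "i < dim_row (mat_adjoint Y * mat_adjoint X)"
    "j < dim_col (mat_adjoint Y * mat_adjoint X)"
  then have ij: "i < d" "j < d" using c by auto
  show "mat_adjoint (X * Y) $$ (i, j) = (mat_adjoint Y * mat_adjoint X) $$ (i, j)"
    using ij c
    by (simp add: mat_adjoint_index[of _ d d] mat_mult_index[of _ d] mult.commute del: index_mult_mat)
qed (use assms in \<open>auto simp: mat_adjoint_def\<close>)

lemma mat_adjoint_sum:
  assumes E: "\<And>p. p \<in> I \<Longrightarrow> E p \<in> carrier_mat d d"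
  shows "mat_adjoint (mat_sum d E I) = mat_sum d (\<lambda>p. mat_adjoint (E p)) I"
proof (rule eq_matI)
  fix i j assume "i < dim_row (mat_sum d (\<lambda>p. mat_adjoint (E p)) I)"
    "j < dim_col (mat_sum d (\<lambda>p. mat_adjoint (E p)) I)"
  then show "mat_adjoint (mat_sum d E I) $$ (i, j) = mat_sum d (\<lambda>p. mat_adjoint (E p)) I $$ (i, j)"
    using E by (simp add: mat_adjoint_index[of _ d d] mat_sum_index)
qed (auto simp: mat_adjoint_def)

section \<open>Projectors and orthogonality of the outcomes of a PVM\<close>

lemma projectorD:
  assumes "projector d p"
  shows "p \<in> carrier_mat d d" "mat_adjoint p = p" "p * p = p"
  using assms by (auto simp: projector_def)

lemma pvm_iff:
  assumes "finite B"
  shows "pvm d B P \<longleftrightarrow> (\<forall>b\<in>B. projector d (P b)) \<and> mat_sum d P B = 1\<^sub>m d"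
  unfolding pvm_def using finsum_module_mat[OF assms, of P d] by (metis projectorD(1))

text \<open>Compressing the decomposition of the identity by the projector \<open>p\<close> of outcome \<open>a\<close> leaves
  a sum of the positive operators \<open>p * q * p = (q * p)\<^sup>* * (q * p)\<close> that vanishes, hence so
  do its diagonal entries, which are sums of squared moduli.\<close>

lemma pvm_orthogonal:
  assumes B: "finite B" and P: "pvm d B P" and a: "a \<in> B" and b: "b \<in> B" and "a \<noteq> b"
  shows "P b * P a = 0\<^sub>m d d"
proof -
  have proj: "projector d (P c)" if "c \<in> B" for c
    using P that by (simp add: pvm_iff[OF B])
  note [simp] = projectorD[OF proj]
  define X where "X c = P c * P a" for c
  have X: "X c \<in> carrier_mat d d" if "c \<in> B" for c
    using that a by (simp add: X_def mult_carrier_mat[of _ d d])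
  have PX: "P a * X c = mat_adjoint (X c) * X c" if c: "c \<in> B" for c
  proof -
    have "mat_adjoint (X c) * X c = (P a * P c) * (P c * P a)"
      using a c by (simp add: X_def mat_adjoint_mult[of _ d])
    also have "\<dots> = P a * ((P c * P c) * P a)"
      using a c by (simp add: assoc_mult_mat[of _ d d _ d _ d] mult_carrier_mat[of _ d d] del: projectorD(3)[OF proj])
    finally show ?thesis using c by (simp add: X_def)
  qed
  have "mat_sum d X B = P a"
    using a mat_sum_mult_right[of "P a" d B P] P left_mult_one_mat[of "P a" d d]
    by (simp add: X_def[abs_def] pvm_iff[OF B])
  then have S: "mat_sum d (\<lambda>c. P a * X c) B = P a"
    using a X mat_sum_mult_left[of "P a" d B X] by simp
  have "X b $$ (k, i) = 0" if i: "i < d" and k: "k < d" for i k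
  proof -
    have sq: "(P a * X c) $$ (i, i) = of_real (\<Sum>k<d. (cmod (X c $$ (k, i)))\<^sup>2)" if "c \<in> B" for c
      using that X i unfolding PX[OF that]
      by (simp add: mat_mult_index[of _ d] mat_adjoint_index[of _ d d] mat_adjoint_carrier
          complex_norm_square mult.commute del: index_mult_mat of_real_power)
    have "P a $$ (i, i) = (\<Sum>c\<in>B. (P a * X c) $$ (i, i))"
      using arg_cong[OF S, of "\<lambda>M. M $$ (i, i)"] i by (simp add: mat_sum_index)
    also have "\<dots> = (P a * X a) $$ (i, i) + (\<Sum>c\<in>B - {a}. (P a * X c) $$ (i, i))"
      using B a by (rule sum.remove)
    \<comment> \<open>The term of outcome \<open>a\<close> alone already accounts for
      \<open>P a\<close>, so the remaining terms sum to zero.\<close>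
    also have "P a * X a = P a"
      using a by (simp add: X_def)
    finally have "(\<Sum>c\<in>B - {a}. (P a * X c) $$ (i, i)) = 0" by simp
    then have "complex_of_real (\<Sum>c\<in>B - {a}. \<Sum>k<d. (cmod (X c $$ (k, i)))\<^sup>2) = 0"
      by (simp add: sq)
    then have "(\<Sum>c\<in>B - {a}. \<Sum>k<d. (cmod (X c $$ (k, i)))\<^sup>2) = 0"
      unfolding of_real_eq_0_iff .
    then have "\<forall>c\<in>B - {a}. (\<Sum>k<d. (cmod (X c $$ (k, i)))\<^sup>2) = 0"
      using B by (subst (asm) sum_nonneg_eq_0_iff) (auto intro: sum_nonneg)
    then have "(\<Sum>k<d. (cmod (X b $$ (k, i)))\<^sup>2) = 0"
      using b \<open>a \<noteq> b\<close> by simp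
    then show ?thesis
      using k by (subst (asm) sum_nonneg_eq_0_iff) auto
  qed
  then show ?thesis
    using X[OF b] unfolding X_def by (intro eq_matI) auto
qed

lemma pvm_mult:
  assumes "finite B" and "pvm d B P" and "a \<in> B" and "b \<in> B"
  shows "P a * P b = (if a = b then P a else 0\<^sub>m d d)"
  using assms pvm_orthogonal[OF assms(1,2,4,3)] projectorD(3)[of d "P a"]
  by (auto simp: pvm_iff)

section \<open>Partial sums, pushforwards and products of PVMs\<close>

text \<open>Read \<open>mat_sum d E S\<close> as the projector of the event \<open>S\<close>. In the
  double sum the cross terms vanish by orthogonality and the diagonal terms contract by idempotence.
  In particular, any two events of one PVM commute.\<close>

lemma pvm_mat_sum_mult:
  assumes I: "finite I" and E: "pvm d I E" and "S \<subseteq> I" "T \<subseteq> I"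
  shows "mat_sum d E S * mat_sum d E T = mat_sum d E (S \<inter> T)"
proof -
  have c: "E p \<in> carrier_mat d d" if "p \<in> I" for p
    using that E projectorD(1) by (auto simp: pvm_iff[OF I])
  have "mat_sum d E S * mat_sum d E T = mat_sum d (\<lambda>p. mat_sum d (\<lambda>q. E p * E q) T) S"
    using assms(3,4) c
    by (subst mat_sum_mult_right) (auto intro!: mat_sum_cong mat_sum_mult_left)
  also have "\<dots> = mat_sum d E (S \<inter> T)"
  proof (rule eq_matI)
    fix i j assume "i < dim_row (mat_sum d E (S \<inter> T))" "j < dim_col (mat_sum d E (S \<inter> T))"
    then have ij: "i < d" "j < d" by auto
    have fin: "finite S" "finite T" using assms(3,4) I finite_subset by auto
    have "(\<Sum>q\<in>T. (E p * E q) $$ (i, j)) = (if p \<in> T then E p $$ (i, j) else 0)"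
      if "p \<in> S" for p
    proof -
      have "(\<Sum>q\<in>T. (E p * E q) $$ (i, j)) = (\<Sum>q\<in>T. if p = q then E p $$ (i, j) else 0)"
        using that assms(3,4) ij by (intro sum.cong) (auto simp: pvm_mult[OF I E] subsetD)
      then show ?thesis using fin by simp
    qed
    then show "mat_sum d (\<lambda>p. mat_sum d (\<lambda>q. E p * E q) T) S $$ (i, j) =
        mat_sum d E (S \<inter> T) $$ (i, j)"
      using ij fin by (simp add: mat_sum_index sum.inter_restrict)
  qed auto
  finally show ?thesis .
qed

lemma pvm_mat_sum_projector:
  assumes I: "finite I" and E: "pvm d I E" and S: "S \<subseteq> I"
  shows "projector d (mat_sum d E S)"
proof -
  have p: "projector d (E p)" if "p \<in> S" for p
    using that S E by (auto simp: pvm_iff[OF I])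
  then have "mat_adjoint (mat_sum d E S) = mat_sum d E S"
    using projectorD(1) by (subst mat_adjoint_sum) (auto intro!: mat_sum_cong projectorD(2))
  then show ?thesis
    using pvm_mat_sum_mult[OF I E S S] by (simp add: projector_def)
qed

text \<open>Pushforward of a PVM along \<open>f\<close>: the fibres of \<open>f\<close> partition
  \<open>I\<close>, so the event projectors still sum to the identity.\<close>

lemma pvm_push:
  assumes I: "finite I" and B: "finite B" and E: "pvm d I E" and f: "f ` I \<subseteq> B"
  shows "pvm d B (\<lambda>b. mat_sum d E {p \<in> I. f p = b})"
proof -
  have "mat_sum d (\<lambda>b. mat_sum d E {p \<in> I. f p = b}) B = mat_sum d E I"
    using sum.group[OF I B f] by (intro eq_matI) (auto simp: mat_sum_index)
  then show ?thesis
    using E pvm_mat_sum_projector[OF I E] by (simp add: pvm_iff[OF I] pvm_iff[OF B])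
qed

text \<open>The joint measurement of two commuting PVMs, together with its two marginals.\<close>

lemma pvm_product:
  assumes A: "finite A" and B: "finite B" and P: "pvm d A P" and P': "pvm d B P'"
    and comm: "\<And>a b. a \<in> A \<Longrightarrow> b \<in> B \<Longrightarrow> P a * P' b = P' b * P a"
  shows "pvm d (A \<times> B) (\<lambda>(a, b). P a * P' b)"
    and "\<And>a. a \<in> A \<Longrightarrow> mat_sum d (\<lambda>(a, b). P a * P' b) ({a} \<times> B) = P a"
    and "\<And>b. b \<in> B \<Longrightarrow> mat_sum d (\<lambda>(a, b). P a * P' b) (A \<times> {b}) = P' b"
proof -
  have p: "projector d (P a)" if "a \<in> A" for a using P that by (simp add: pvm_iff[OF A])
  have p': "projector d (P' b)" if "b \<in> B" for b using P' that by (simp add: pvm_iff[OF B])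
  \<comment> \<open>Sums over rectangles factor. The full rectangle gives normalisation, and
    rectangles with one singleton side give the marginals.\<close>
  have iter: "mat_sum d (\<lambda>(a, b). P a * P' b) (S \<times> T) = mat_sum d P S * mat_sum d P' T"
    if "S \<subseteq> A" "T \<subseteq> B" for S T
  proof -
    have c: "P a \<in> carrier_mat d d" "P' b \<in> carrier_mat d d" if "a \<in> S" "b \<in> T" for a b
      using that \<open>S \<subseteq> A\<close> \<open>T \<subseteq> B\<close> p p' projectorD(1) by blast+
    have "mat_sum d (\<lambda>(a, b). P a * P' b) (S \<times> T) = mat_sum d (\<lambda>a. mat_sum d (\<lambda>b. P a * P' b) T) S"
      by (intro eq_matI) (auto simp: mat_sum_index sum.cartesian_product intro!: sum.cong)
    also have "\<dots> = mat_sum d (\<lambda>a. P a * mat_sum d P' T) S"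
      using that p p' projectorD(1) by (intro mat_sum_cong mat_sum_mult_left[symmetric]) blast+
    also have "\<dots> = mat_sum d P S * mat_sum d P' T"
      using that c p projectorD(1) by (intro mat_sum_mult_right[symmetric] mat_sum_carrier) blast
    finally show ?thesis .
  qed
  have singles: "mat_sum d P {a} = P a" if "a \<in> A" for a
    using projectorD(1)[OF p[OF that]] by (intro eq_matI) (auto simp: mat_sum_index)
  have singles': "mat_sum d P' {b} = P' b" if "b \<in> B" for b
    using projectorD(1)[OF p'[OF that]] by (intro eq_matI) (auto simp: mat_sum_index)
  have one: "mat_sum d P A = 1\<^sub>m d" "mat_sum d P' B = 1\<^sub>m d"
    using P P' by (auto simp: pvm_iff[OF A] pvm_iff[OF B])
  have "projector d (P a * P' b)" if ab: "a \<in> A" "b \<in> B" for a b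
  proof -
    note [simp] = projectorD[OF p[OF ab(1)]] projectorD[OF p'[OF ab(2)]]
    \<comment> \<open>Commuting the second factor brings the two copies of \<open>P' b\<close>
      together; after they contract, commuting back does the same for \<open>P a\<close>.\<close>
    have "(P a * P' b) * (P a * P' b) = (P a * P' b) * (P' b * P a)"
      by (simp add: comm ab)
    also have "\<dots> = P a * ((P' b * P' b) * P a)"
      by (simp add: assoc_mult_mat[of _ d d _ d _ d] mult_carrier_mat[of _ d d]
          del: projectorD(3)[OF p'[OF ab(2)]])
    also have "\<dots> = P a * (P a * P' b)" by (simp add: comm ab)
    also have "\<dots> = (P a * P a) * P' b"
      by (rule assoc_mult_mat[symmetric, of _ d d _ d _ d]) auto
    finally have "(P a * P' b) * (P a * P' b) = P a * P' b" by simp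
    then show ?thesis
      by (simp add: projector_def mult_carrier_mat[of _ d d] mat_adjoint_mult[of _ d] comm ab)
  qed
  then show "pvm d (A \<times> B) (\<lambda>(a, b). P a * P' b)"
    using A B iter[of A B] one by (simp add: pvm_iff)
  show "mat_sum d (\<lambda>(a, b). P a * P' b) ({a} \<times> B) = P a" if "a \<in> A" for a
    using iter[of "{a}" B] that one singles right_mult_one_mat[OF projectorD(1)[OF p]] by simp
  show "mat_sum d (\<lambda>(a, b). P a * P' b) (A \<times> {b}) = P' b" if "b \<in> B" for b
    using iter[of A "{b}"] that one singles' left_mult_one_mat[OF projectorD(1)[OF p']] by simp
qed

section \<open>Classical homomorphisms\<close>

definition is_hom ::
    "'r signature \<Rightarrow> ('a, 'r) rel_struct \<Rightarrow> ('b, 'r) rel_struct \<Rightarrow> ('a \<Rightarrow> 'b) \<Rightarrow> bool" where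
  "is_hom \<sigma> A B f \<longleftrightarrow> f ` universe A \<subseteq> universe B \<and>
     (\<forall>R\<in>symbols \<sigma>. \<forall>t\<in>interp A R. map f t \<in> interp B R)"

lemma is_structure_power:
  assumes "is_structure \<sigma> A"
  shows "is_structure \<sigma> (struct_power \<sigma> A n)"
  using assms finite_lists_length_eq[of "universe A" n]
  by (auto simp: is_structure_def struct_power_def tuples_def)

lemma is_hom_power_nth:
  assumes "i < n"
  shows "is_hom \<sigma> (struct_power \<sigma> A n) A (\<lambda>x. x ! i)"
  using assms by (fastforce simp: is_hom_def struct_power_def tuples_def)

text \<open>Universal property of the power: its relations are tested coordinatewise, so a family of
  homomorphisms combines into one.\<close>

lemma is_hom_power_tuple:
  assumes G: "is_structure \<sigma> G" and h: "\<And>i. i < n \<Longrightarrow> is_hom \<sigma> G A (h i)"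
  shows "is_hom \<sigma> G (struct_power \<sigma> A n) (\<lambda>g. map (\<lambda>i. h i g) [0..<n])"
proof -
  have U: "map (\<lambda>i. h i g) [0..<n] \<in> tuples (universe A) n" if "g \<in> universe G" for g
    using h that by (fastforce simp: is_hom_def tuples_def)
  have "map (\<lambda>g. map (\<lambda>i. h i g) [0..<n]) t \<in> interp (struct_power \<sigma> A n) R"
    if R: "R \<in> symbols \<sigma>" and t: "t \<in> interp G R" for R t
  proof -
    have "map (\<lambda>b. b ! i) (map (\<lambda>g. map (\<lambda>i. h i g) [0..<n]) t) = map (h i) t" if "i < n" for i
      using that by simp
    moreover have "map (h i) t \<in> interp A R" if "i < n" for i
      using h[OF that] R t by (simp add: is_hom_def)
    moreover have "t \<in> tuples (universe G) (arity \<sigma> R)"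
      using G R t by (auto simp: is_structure_def)
    ultimately show ?thesis
      using U by (auto simp: struct_power_def tuples_def[of "tuples (universe A) n"]
          tuples_def[of "universe G"] simp del: map_map)
  qed
  then show ?thesis
    using U by (auto simp: is_hom_def struct_power_def)
qed

section \<open>Quantum homomorphisms from classical ones and back\<close>

text \<open>Each factor is an event projector, so the product belongs to the intersection of the
  events. The empty product matches the full event \<open>I\<close>, whose projector is the
  identity.\<close>

lemma mat_prod_list_pvm:
  assumes I: "finite I" and E: "pvm d I E" and "length xs = length bs"
  shows "mat_prod_list d (map2 (\<lambda>x b. mat_sum d E {p \<in> I. f p x = b}) xs bs) =
    mat_sum d E {p \<in> I. map (f p) xs = bs}"
  using assms(3)
proof (induction xs bs rule: list_induct2)
  case Nil
  then show ?case using E by (simp add: mat_prod_list_def pvm_iff[OF I])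
next
  case (Cons x xs b bs)
  have "{p \<in> I. f p x = b} \<inter> {p \<in> I. map (f p) xs = bs} =
      {p \<in> I. map (f p) (x # xs) = b # bs}" by auto
  with Cons show ?case
    by (simp add: mat_prod_list_def pvm_mat_sum_mult[OF I E])
qed

text \<open>Measure \<open>E\<close> once and apply the homomorphism \<open>f p\<close> selected by
  the outcome \<open>p\<close>. A tuple outside the relation is never the image of a related tuple,
  so its event is empty, which gives (QH1); (QH2) holds because all operators are events of the same
  \<open>E\<close>.\<close>

lemma quantum_hom_mixture:
  assumes A: "is_structure \<sigma> A" and B: "is_structure \<sigma> B" and I: "finite I" and d: "d > 0"
    and E: "pvm d I E" and f: "\<And>p. p \<in> I \<Longrightarrow> is_hom \<sigma> A B (f p)"
  shows "quantum_hom \<sigma> A B d (\<lambda>x b. mat_sum d E {p \<in> I. f p x = b})"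
proof -
  have B': "finite (universe B)" using B by (simp add: is_structure_def)
  have "pvm d (universe B) (\<lambda>b. mat_sum d E {p \<in> I. f p x = b})" if "x \<in> universe A" for x
    using f that by (intro pvm_push[OF I B' E]) (auto simp: is_hom_def)
  moreover have "mat_prod_list d (map2 (\<lambda>x b. mat_sum d E {p \<in> I. f p x = b}) as bs) = 0\<^sub>m d d"
    if "R \<in> symbols \<sigma>" "as \<in> interp A R" "bs \<in> tuples (universe B) (arity \<sigma> R) - interp B R"
    for R as bs
  proof -
    have "length as = length bs"
      using that A by (auto simp: is_structure_def tuples_def)
    moreover have "{p \<in> I. map (f p) as = bs} = {}"
      using f that by (auto simp: is_hom_def)
    ultimately show ?thesis
      using mat_prod_list_pvm[OF I E, of as bs f] by (simp only: mat_sum_empty)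
  qed
  ultimately show ?thesis
    using d by (auto simp: quantum_hom_def quantum_function_def pvm_mat_sum_mult[OF I E] Int_commute)
qed

section \<open>Deterministic PVMs and dimension one\<close>

lemma pvm_deterministic:
  assumes B: "finite B" and b: "b \<in> B"
  shows "pvm d B (\<lambda>c. if c = b then 1\<^sub>m d else 0\<^sub>m d d)"
proof -
  have "mat_adjoint (1\<^sub>m d :: complex mat) = 1\<^sub>m d"
    using mat_adjoint_carrier[of "1\<^sub>m d :: complex mat" d d]
    by (intro eq_matI) (auto simp: mat_adjoint_index[of _ d d])
  moreover have "mat_adjoint (0\<^sub>m d d :: complex mat) = 0\<^sub>m d d"
    using mat_adjoint_carrier[of "0\<^sub>m d d :: complex mat" d d]
    by (intro eq_matI) (auto simp: mat_adjoint_index[of _ d d])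
  ultimately show ?thesis
    using b B by (auto simp: pvm_iff projector_def mat_sum_index if_distrib[of "\<lambda>M. M $$ _"]
        intro!: eq_matI cong: if_cong)
qed

lemma projector_dim_1:
  assumes "projector 1 p"
  shows "p = 0\<^sub>m 1 1 \<or> p = 1\<^sub>m 1"
proof -
  have p: "p \<in> carrier_mat 1 1" and pp: "p * p = p"
    using projectorD[OF assms] by auto
  have "p $$ (0, 0) * p $$ (0, 0) = p $$ (0, 0)"
    using arg_cong[OF pp, of "\<lambda>M. M $$ (0, 0)"] p mat_mult_index[OF p p, of 0 0] by simp
  then have "p $$ (0, 0) = 0 \<or> p $$ (0, 0) = 1" by simp
  then show ?thesis using p by (auto intro: eq_matI)
qed

text \<open>In dimension one every projector is 0 or 1, and normalisation forces some outcome to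
  have projector 1; \<open>h\<close> selects such an outcome.\<close>

lemma quantum_hom_dim_1:
  assumes G: "is_structure \<sigma> G" and A: "finite (universe A)" and Q: "quantum_hom \<sigma> G A 1 Q"
  obtains h where "is_hom \<sigma> G A h" and "\<And>g. g \<in> universe G \<Longrightarrow> Q g (h g) = 1\<^sub>m 1"
proof -
  have "\<exists>a\<in>universe A. Q g a = 1\<^sub>m 1" if g: "g \<in> universe G" for g
  proof (rule ccontr)
    assume no: "\<not> ?thesis"
    have P: "pvm 1 (universe A) (Q g)"
      using Q g by (simp add: quantum_hom_def quantum_function_def)
    then have "Q g a = 0\<^sub>m 1 1" if "a \<in> universe A" for a
      using projector_dim_1 that no by (auto simp: pvm_iff[OF A])
    then have "mat_sum 1 (Q g) (universe A) $$ (0, 0) = 0"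
      by (simp add: mat_sum_index)
    then show False using P by (simp add: pvm_iff[OF A])
  qed
  then obtain h where h: "\<And>g. g \<in> universe G \<Longrightarrow> h g \<in> universe A \<and> Q g (h g) = 1\<^sub>m 1"
    by metis
  have "map h t \<in> interp A R" if R: "R \<in> symbols \<sigma>" and t: "t \<in> interp G R" for R t
  proof (rule ccontr)
    assume no: "map h t \<notin> interp A R"
    have tG: "set t \<subseteq> universe G" "length t = arity \<sigma> R"
      using G R t by (auto simp: is_structure_def tuples_def)
    \<comment> \<open>If \<open>h\<close> broke the relation, (QH1) would make this product of
      identities vanish.\<close>
    have "mat_prod_list 1 (map2 Q t (map h t)) = 1\<^sub>m 1"
      using tG(1) by (induction t) (simp_all add: mat_prod_list_def h)
    moreover have "map h t \<in> tuples (universe A) (arity \<sigma> R) - interp A R"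
      using no tG h by (auto simp: tuples_def)
    then have "mat_prod_list 1 (map2 Q t (map h t)) = 0\<^sub>m 1 1"
      using Q R t unfolding quantum_hom_def by blast
    ultimately have "(1\<^sub>m 1 :: complex mat) $$ (0, 0) = 0" by simp
    then show False by simp
  qed
  with h that show ?thesis by (force simp: is_hom_def)
qed

text \<open>A homomorphism may collapse a Gaifman edge to a single vertex; commutation is then
  the orthogonality of a PVM.\<close>

lemma quantum_hom_comp:
  assumes G: "is_structure \<sigma> G" and B: "finite (universe B)"
    and h: "is_hom \<sigma> G A h" and Q: "quantum_hom \<sigma> A B d Q"
  shows "quantum_hom \<sigma> G B d (\<lambda>g. Q (h g))"
proof -
  have P: "pvm d (universe B) (Q (h g))" if "g \<in> universe G" for g
    using that h Q by (auto simp: is_hom_def quantum_hom_def quantum_function_def)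
  have "mat_prod_list d (map2 (\<lambda>g. Q (h g)) as bs) = 0\<^sub>m d d"
    if "R \<in> symbols \<sigma>" "as \<in> interp G R" "bs \<in> tuples (universe B) (arity \<sigma> R) - interp B R"
    for R as bs
  proof -
    have "map2 Q (map h as) bs = map2 (\<lambda>g. Q (h g)) as bs"
      by (induction as bs rule: list_induct2') auto
    moreover have "map h as \<in> interp A R" using h that by (auto simp: is_hom_def)
    ultimately show ?thesis using Q that unfolding quantum_hom_def by metis
  qed
  moreover have "Q (h g) b * Q (h g') b' = Q (h g') b' * Q (h g) b"
    if e: "{g, g'} \<in> gaifman_edges \<sigma> G" and b: "b \<in> universe B" "b' \<in> universe B" for g g' b b'
  proof (cases "h g = h g'")
    case True
    then show ?thesis
      using b pvm_mult[OF B P[OF gaifman_edges_subset(1)[OF G e]]] by auto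
  next
    case False
    obtain R t where "R \<in> symbols \<sigma>" "t \<in> interp G R" "g \<in> set t" "g' \<in> set t"
      using e unfolding gaifman_edges_iff by blast
    then have "{h g, h g'} \<in> gaifman_edges \<sigma> A"
      unfolding gaifman_edges_iff using False h by (force simp: is_hom_def)
    then show ?thesis using Q b unfolding quantum_hom_def by blast
  qed
  ultimately show ?thesis
    using P Q unfolding quantum_hom_def quantum_function_def by blast
qed

section \<open>Commutativity gadgets\<close>

text \<open>Condition (c1) is applied only in dimension 1, to build classical homomorphisms; (c2) is
  applied in the dimension \<open>d\<close> of the given \<open>Q\<close>.\<close>

lemma gadget_imp_non_contextual:
  fixes A :: "('a, 'r) rel_struct"
  assumes A: "is_structure \<sigma> A" and g: "commutativity_gadget \<sigma> A G u v"
    and Q: "quantum_hom \<sigma> (struct_power \<sigma> A n) A d Q"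
  shows "non_contextual (universe (struct_power \<sigma> A n)) (universe A) Q"
  unfolding non_contextual_def
proof (intro ballI)
  fix x y a b
  assume "x \<in> universe (struct_power \<sigma> A n)" "y \<in> universe (struct_power \<sigma> A n)"
    and ab: "a \<in> universe A" "b \<in> universe A"
  then have x: "length x = n" "set x \<subseteq> universe A" and y: "length y = n" "set y \<subseteq> universe A"
    by (auto simp: struct_power_def tuples_def)
  have fin: "finite (universe A)" using A by (simp add: is_structure_def)
  note gadget = g[unfolded commutativity_gadget_def]
  note G = gadget[THEN conjunct1] and uv = gadget[THEN conjunct2, THEN conjunct1]
    gadget[THEN conjunct2, THEN conjunct2, THEN conjunct1]
  note c1 = gadget[THEN conjunct2, THEN conjunct2, THEN conjunct2, THEN conjunct1]
    and c2 = gadget[THEN conjunct2, THEN conjunct2, THEN conjunct2, THEN conjunct2]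
  have "\<exists>h. is_hom \<sigma> G A h \<and> h u = x ! i \<and> h v = y ! i" if i: "i < n" for i
  proof -
    define \<delta> :: "'a \<Rightarrow> 'a \<Rightarrow> complex mat"
      where "\<delta> a = (\<lambda>c. if c = a then 1\<^sub>m 1 else 0\<^sub>m 1 1)" for a
    have \<delta>: "pvm 1 (universe A) (\<delta> a)" if "a \<in> universe A" for a
      unfolding \<delta>_def using fin that by (rule pvm_deterministic)
    have xy: "x ! i \<in> universe A" "y ! i \<in> universe A" using i x y by auto
    have "\<exists>Q. quantum_hom \<sigma> G A 1 Q \<and>
        (\<forall>a\<in>universe A. Q u a = \<delta> (x ! i) a \<and> Q v a = \<delta> (y ! i) a)"
      using xy \<delta> by (intro c1[rule_format]) (auto simp: \<delta>_def simp del: One_nat_def)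
    then obtain Q' where Q': "quantum_hom \<sigma> G A 1 Q'"
      and eq: "\<And>a. a \<in> universe A \<Longrightarrow> Q' u a = \<delta> (x ! i) a \<and> Q' v a = \<delta> (y ! i) a"
      by blast
    obtain h where h: "is_hom \<sigma> G A h" and 1: "\<And>g. g \<in> universe G \<Longrightarrow> Q' g (h g) = 1\<^sub>m 1"
      using quantum_hom_dim_1[OF G fin Q'] by blast
    \<comment> \<open>Since identity and zero differ in dimension one, a value 1 of
      \<open>\<delta> (x ! i)\<close> at \<open>h u\<close> forces \<open>h u = x ! i\<close>;
      likewise for \<open>v\<close> and \<open>y\<close>.\<close>
    have "(1\<^sub>m 1 :: complex mat) $$ (0, 0) \<noteq> 0\<^sub>m 1 1 $$ (0, 0)" by simp
    then have ne: "(1\<^sub>m 1 :: complex mat) \<noteq> 0\<^sub>m 1 1" by metis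
    have "h u \<in> universe A" "h v \<in> universe A" using h uv by (auto simp: is_hom_def)
    then have "\<delta> (x ! i) (h u) = 1\<^sub>m 1" "\<delta> (y ! i) (h v) = 1\<^sub>m 1"
      using 1 uv eq by metis+
    then show ?thesis using h ne by (auto simp: \<delta>_def split: if_splits)
  qed
  then obtain h where h: "\<And>i. i < n \<Longrightarrow> is_hom \<sigma> G A (h i) \<and> h i u = x ! i \<and> h i v = y ! i"
    by metis
  let ?h = "\<lambda>g. map (\<lambda>i. h i g) [0..<n]"
  have "?h u = x" "?h v = y" using h x y by (auto intro!: nth_equalityI)
  moreover have "quantum_hom \<sigma> G A d (\<lambda>g. Q (?h g))"
    using h by (intro quantum_hom_comp[OF G fin _ Q] is_hom_power_tuple[OF G]) auto
  ultimately show "Q x a * Q y b = Q y b * Q x a"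
    using c2[rule_format, of d "\<lambda>g. Q (?h g)" a b] ab by simp
qed

text \<open>The bound on \<open>n\<close> leaves room for a separate coordinate for each pair of
  elements; (c1) is then a mixture of projections, and (c2) is non-contextuality at \<open>u\<close>
  and \<open>v\<close>.\<close>

lemma non_contextual_imp_power_gadget:
  fixes A :: "('a, 'r) rel_struct"
  assumes A: "is_structure \<sigma> A" and ne: "universe A \<noteq> {}"
    and n: "n \<ge> card (universe A \<times> universe A)"
    and nc: "\<And>d Q. quantum_hom \<sigma> (struct_power \<sigma> A n) A d Q \<Longrightarrow>
      non_contextual (universe (struct_power \<sigma> A n)) (universe A) Q"
  shows "\<exists>u v. commutativity_gadget \<sigma> A (struct_power \<sigma> A n) u v"
proof -
  let ?U = "universe A"
  have fin: "finite ?U" using A by (simp add: is_structure_def)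
  obtain k :: "'a \<times> 'a \<Rightarrow> nat" where k: "inj_on k (?U \<times> ?U)" "k ` (?U \<times> ?U) \<subseteq> {..<n}"
    using card_le_inj[of "?U \<times> ?U" "{..<n}"] fin n by auto
  obtain a0 where a0: "a0 \<in> ?U" using ne by blast
  \<comment> \<open>\<open>e\<close> reads off the pair assigned to coordinate \<open>i\<close>.
    Coordinates outside the image of \<open>k\<close> get the default \<open>(a0, a0)\<close>, which
    only keeps \<open>u\<close> and \<open>v\<close> inside the power.\<close>
  define e where "e i = (if i \<in> k ` (?U \<times> ?U) then inv_into (?U \<times> ?U) k i else (a0, a0))" for i
  define u where "u = map (\<lambda>i. fst (e i)) [0..<n]"
  define v where "v = map (\<lambda>i. snd (e i)) [0..<n]"
  have "e i \<in> ?U \<times> ?U" for i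
    using a0 inv_into_into[of i k "?U \<times> ?U"] by (auto simp: e_def simp del: inv_into_into)
  then have uvU: "u \<in> universe (struct_power \<sigma> A n)" "v \<in> universe (struct_power \<sigma> A n)"
    by (auto simp: u_def v_def struct_power_def tuples_def mem_Times_iff)
  have nth: "u ! k p = fst p" "v ! k p = snd p" "k p < n" if "p \<in> ?U \<times> ?U" for p
  proof -
    show "k p < n" using k(2) that by blast
    moreover have "e (k p) = p" using that k(1) by (simp add: e_def)
    ultimately show "u ! k p = fst p" "v ! k p = snd p" by (auto simp: u_def v_def)
  qed
  have ex: "\<exists>Q. quantum_hom \<sigma> (struct_power \<sigma> A n) A d Q \<and> (\<forall>a\<in>?U. Q u a = P a \<and> Q v a = P' a)"
    if d: "d > 0" and P: "pvm d ?U P" and P': "pvm d ?U P'"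
      and comm: "\<And>a b. a \<in> ?U \<Longrightarrow> b \<in> ?U \<Longrightarrow> P a * P' b = P' b * P a" for d P P'
  proof (intro exI conjI ballI)
    define E where "E = (\<lambda>(a, b). P a * P' b)"
    \<comment> \<open>On joint outcome \<open>p\<close>, the coordinate \<open>k p\<close> of
      \<open>x\<close> is returned; at \<open>u\<close> this is \<open>fst p\<close> and at
      \<open>v\<close> it is \<open>snd p\<close>.\<close>
    define Q where "Q x a = mat_sum d E {p \<in> ?U \<times> ?U. x ! k p = a}" for x and a :: 'a
    note prod = pvm_product[OF fin fin P P' comm, folded E_def]
    show "quantum_hom \<sigma> (struct_power \<sigma> A n) A d Q"
      unfolding Q_def using fin nth(3) prod(1)
      by (intro quantum_hom_mixture is_structure_power A d is_hom_power_nth) auto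
    fix a assume a: "a \<in> ?U"
    \<comment> \<open>These events are a row and a column of the square, so their projectors are the
      marginals of \<open>E\<close>.\<close>
    have "{p \<in> ?U \<times> ?U. u ! k p = a} = {a} \<times> ?U" "{p \<in> ?U \<times> ?U. v ! k p = a} = ?U \<times> {a}"
      using a by (auto simp: nth)
    then show "Q u a = P a" "Q v a = P' a"
      using prod(2,3) a by (simp_all add: Q_def)
  qed
  have "commutativity_gadget \<sigma> A (struct_power \<sigma> A n) u v"
    unfolding commutativity_gadget_def
    using ex nc uvU is_structure_power[OF A] unfolding non_contextual_def by blast
  then show ?thesis by blast
qed

theorem theorem6:
  fixes \<sigma> :: "'r signature" and A :: "('a, 'r) rel_struct"
  assumes "is_signature \<sigma>"
    and "is_structure \<sigma> A"
    and "universe A \<noteq> {}"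
  shows "(has_commutativity_gadget \<sigma> A \<longleftrightarrow>
            (\<exists>N. \<forall>n\<ge>N. n \<ge> 1 \<longrightarrow> (\<exists>u v. commutativity_gadget \<sigma> A (struct_power \<sigma> A n) u v))) \<and>
         (has_commutativity_gadget \<sigma> A \<longleftrightarrow>
            (\<forall>n d Q. quantum_polymorphism \<sigma> A n d Q \<longrightarrow>
               non_contextual (universe (struct_power \<sigma> A n)) (universe A) Q))"
    (is "(?gadget \<longleftrightarrow> ?power) \<and> (?gadget \<longleftrightarrow> ?nc)")
proof -
  \<comment> \<open>Both equivalences follow from the cycle \<open>?gadget\<close>,
    \<open>?nc\<close>, \<open>?power\<close>, \<open>?gadget\<close>.\<close>
  have "?nc" if gadget: ?gadget
  proof -
    obtain G :: "(nat, 'r) rel_struct" and u v where g: "commutativity_gadget \<sigma> A G u v"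
      using gadget unfolding has_commutativity_gadget_def by blast
    show ?thesis
      using gadget_imp_non_contextual[OF assms(2) g] unfolding quantum_polymorphism_def by blast
  qed
  \<comment> \<open>The threshold is the number of pairs of elements; the guard
    \<open>n \<ge> 1\<close> is what \<open>quantum_polymorphism\<close> demands of the
    exponent.\<close>
  moreover have "?power" if ?nc
    using that non_contextual_imp_power_gadget[OF assms(2,3)]
    unfolding quantum_polymorphism_def by meson
  moreover have "?gadget" if power: ?power
  proof -
    obtain N where "\<forall>n\<ge>N. n \<ge> 1 \<longrightarrow> (\<exists>u v. commutativity_gadget \<sigma> A (struct_power \<sigma> A n) u v)"
      using power by blast
    \<comment> \<open>\<open>Suc N\<close> meets both the threshold and the guard
      \<open>n \<ge> 1\<close>. The power has lists as elements, so its domain is then transferred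
      to the naturals.\<close>
    then have "\<exists>u v. commutativity_gadget \<sigma> A (struct_power \<sigma> A (Suc N)) u v" by simp
    then show ?thesis by (elim exE) (rule has_commutativity_gadgetI)
  qed
  ultimately show ?thesis by blast
qed

end
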